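(* Let $p$ be an odd prime and let $g,s,\ell$ be positive integers. Let $z=(z_1,\dots,z_{2g+1})$ be variables and let $I^\ell(z,\lambda)=(I_1^\ell(z,\lambda),\dots,I_{2g+1}^\ell(z,\lambda))$ be the vector of polynomials in $z,\lambda$ with coefficients in $\mathbb Z_p$ defined as the coefficient of $t^{\ell p^s-1}$ in the polynomial (in $t$) vector $$\Psi_s(t,z,\lambda)=E_s(p\lambda t)\prod_{i=1}^{2g+1}(t-z_i)^{(p^s-1)/2}\left(\frac1{t-z_1},\dots,\frac1{t-z_{2g+1}}\right).$$ (1) If $\lambda\in\mathbb Z_p$, then $I=I^\ell(z,\lambda)$ is a solution modulo $p^s$ of the KZ equations $$\frac{\partial I_j}{\partial z_i}=\frac12\frac{I_i-I_j}{z_i-z_j}\ (i\neq j),\qquad \frac{\partial I_i}{\partial z_i}=p\lambda I_i-\frac12\sum_{j\ne i}\frac{I_i-I_j}{z_i-z_j}.$$ (2) If $\lambda\in\mathbb Z_p^\times$, then $I=I^\ell(z,\lambda)$ is a solution modulo $p^s$ of the dynamical equations $$\frac{\partial I_i}{\partial\lambda}=pz_iI_i+\frac1{2\lambda}\sum_{j=1}^{2g+1}I_j,\qquad i=1,\dots,2g+1.$$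
   Context: $\mathbb Z_p$ is the ring of $p$-adic integers. For a positive integer $s$ put $d(s)=\left[s\frac{p-1}{p-2}\right]+1$ (where $[\cdot]$ is the integer part) and $E_s(t)=\sum_{k=0}^{d(s)}\frac{t^k}{k!}$; the polynomial $E_s(p\lambda t)$ in $t,\lambda$ has coefficients in $\mathbb Z_p$. "Solution modulo $p^s$" for a given value of $\lambda$ means: after taking the derivatives of the polynomials $I^\ell_i(z,\lambda)$ (with respect to $z_i$, respectively $\lambda$) and substituting the given value of $\lambda$, the difference of the two sides of each equation lies in $p^sR$, where $R=\mathbb Z_p[z_1,\dots,z_{2g+1}]\big[(z_i-z_j)^{-1},\ i\ne j\big]$. *)

theory Defs
  imports
    "HOL-Library.Poly_Mapping"
    "HOL-Computational_Algebra.Computational_Algebra"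
    "HOL-Number_Theory.Number_Theory"
    "Berlekamp_Zassenhaus.Finite_Field"
begin

section \<open>The ring of p-adic integers\<close>

text \<open>
  The prime \<open>p\<close> is the cardinality of a type of class \<^class>\<open>prime_card\<close>.
  A p-adic integer is a compatible sequence \<open>x\<close> of residues: an element of the inverse limit
  of the rings \<open>\<int>/p\<^sup>n\<close>, where \<open>x n\<close> is the representative in \<open>{0..<p\<^sup>n}\<close>
  (the equation below also enforces this range).
\<close>

typedef 'p padic_int = "{x :: nat \<Rightarrow> int. \<forall>n. x (Suc n) mod int CARD('p) ^ n = x n}"
  by (rule exI[of _ "\<lambda>_. 0"]) simp

setup_lifting type_definition_padic_int

lemma mod_power_Suc_mod: "(a mod (q::int) ^ Suc n) mod q ^ n = a mod q ^ n"
  by (rule mod_mod_cancel) (simp add: le_imp_power_dvd)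

lemma compat1:
  assumes "\<forall>n. x (Suc n) mod (q::int) ^ n = x n"
    and "\<And>a m. h (a mod m) mod m = h a mod m"
  shows "(h (x (Suc n)) mod q ^ Suc n) mod q ^ n = h (x n) mod q ^ n"
  unfolding mod_power_Suc_mod using assms by metis

lemma compat2:
  assumes "\<forall>n. x (Suc n) mod (q::int) ^ n = x n" "\<forall>n. y (Suc n) mod q ^ n = y n"
    and "\<And>a b m. h (a mod m) (b mod m) mod m = h a b mod m"
  shows "(h (x (Suc n)) (y (Suc n)) mod q ^ Suc n) mod q ^ n = h (x n) (y n) mod q ^ n"
  unfolding mod_power_Suc_mod using assms by metis

instantiation padic_int :: (prime_card) comm_ring_1
begin

lift_definition zero_padic_int :: "'a padic_int" is "\<lambda>_. 0" by simp

lift_definition one_padic_int :: "'a padic_int" is "\<lambda>n. 1 mod int CARD('a) ^ n"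
  by (simp only: mod_power_Suc_mod)

lift_definition plus_padic_int :: "'a padic_int \<Rightarrow> 'a padic_int \<Rightarrow> 'a padic_int"
  is "\<lambda>x y n. (x n + y n) mod int CARD('a) ^ n"
  by (rule compat2) (simp_all add: mod_add_eq)

lift_definition uminus_padic_int :: "'a padic_int \<Rightarrow> 'a padic_int"
  is "\<lambda>x n. (- x n) mod int CARD('a) ^ n"
  by (rule compat1) (simp_all add: mod_minus_eq)

lift_definition minus_padic_int :: "'a padic_int \<Rightarrow> 'a padic_int \<Rightarrow> 'a padic_int"
  is "\<lambda>x y n. (x n - y n) mod int CARD('a) ^ n"
  by (rule compat2) (simp_all add: mod_diff_eq)

lift_definition times_padic_int :: "'a padic_int \<Rightarrow> 'a padic_int \<Rightarrow> 'a padic_int"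
  is "\<lambda>x y n. (x n * y n) mod int CARD('a) ^ n"
  by (rule compat2) (simp_all add: mod_mult_eq)

instance
proof
  fix a b c :: "'a padic_int"
  show "a * b * c = a * (b * c)"
    by transfer (auto simp: fun_eq_iff mod_simps mult.assoc)
  show "a * b = b * a"
    by transfer (auto simp: fun_eq_iff mult.commute)
  show "1 * a = a"
    by transfer (auto simp: fun_eq_iff mod_simps, metis mod_mod_trivial)
  show "a + b + c = a + (b + c)"
    by transfer (auto simp: fun_eq_iff mod_simps add.assoc)
  show "a + b = b + a"
    by transfer (auto simp: fun_eq_iff add.commute)
  show "0 + a = a"
    by transfer (auto simp: fun_eq_iff, metis mod_mod_trivial)
  show "- a + a = 0"
    by transfer (auto simp: fun_eq_iff mod_simps)
  show "a - b = a + - b"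
    by transfer (auto simp: fun_eq_iff mod_simps)
  show "(a + b) * c = a * c + b * c"
    by transfer (auto simp: fun_eq_iff mod_simps algebra_simps)
  show "(0 :: 'a padic_int) \<noteq> 1"
  proof (transfer, rule notI)
    assume "(\<lambda>_. 0) = (\<lambda>n. 1 mod int CARD('a) ^ n)"
    from fun_cong[OF this, of 1] show False
      using prime_gt_1_nat[OF prime_card[where 'a = 'a]] by simp
  qed
qed

end

lemma padic_int_mod:
  assumes "\<forall>n. x (Suc n) mod (q::int) ^ n = x n" and "n \<le> m"
  shows "x m mod q ^ n = x n"
  using assms(2)
proof (induction m rule: dec_induct)
  case base
  show ?case using assms(1) by (metis mod_mod_trivial)
next
  case (step m)
  have "x (Suc m) mod q ^ n = (x (Suc m) mod q ^ m) mod q ^ n"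
    using step.hyps by (simp add: mod_mod_cancel le_imp_power_dvd)
  also have "\<dots> = x n" using assms(1) step.IH by metis
  finally show ?case .
qed

instance padic_int :: (prime_card) idom
proof
  fix a b :: "'a padic_int"
  assume "a \<noteq> 0" "b \<noteq> 0"
  then show "a * b \<noteq> 0"
  proof (transfer, goal_cases)
    case (1 x y)
    let ?p = "int CARD('a)"
    note xs = 1(1) and ys = 1(3)
    obtain n where n: "x n \<noteq> 0" using 1(2) by blast
    obtain m where m: "y m \<noteq> 0" using 1(4) by blast
    have pp: "prime ?p" by (rule prime_card_int)
    have x: "\<not> ?p ^ n dvd x (n + m)"
      using padic_int_mod[OF xs, of n "n + m"] n by (simp add: dvd_eq_mod_eq_0)
    have y: "\<not> ?p ^ m dvd y (n + m)"
      using padic_int_mod[OF ys, of m "n + m"] m by (simp add: dvd_eq_mod_eq_0)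
    have x0: "x (n + m) \<noteq> 0" and y0: "y (n + m) \<noteq> 0" using x y by auto
    have unit: "\<not> is_unit ?p" using pp not_prime_unit by blast
    have "multiplicity ?p (x (n + m)) < n" "multiplicity ?p (y (n + m)) < m"
      using x y x0 y0 unit by (simp_all add: power_dvd_iff_le_multiplicity not_le)
    moreover have "multiplicity ?p (x (n + m) * y (n + m))
        = multiplicity ?p (x (n + m)) + multiplicity ?p (y (n + m))"
      using pp x0 y0 by (intro prime_elem_multiplicity_mult_distrib) auto
    ultimately have "multiplicity ?p (x (n + m) * y (n + m)) < n + m" by linarith
    hence "\<not> ?p ^ (n + m) dvd x (n + m) * y (n + m)"
      using x0 y0 unit by (subst power_dvd_iff_le_multiplicity) auto
    hence "(x (n + m) * y (n + m)) mod ?p ^ (n + m) \<noteq> 0"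
      by (simp add: dvd_eq_mod_eq_0)
    then show ?case by (metis (no_types))
  qed
qed

lemma Rep_padic_int_of_nat:
  "Rep_padic_int (of_nat m :: 'p::prime_card padic_int) n = int m mod int CARD('p) ^ n"
  by (induction m) (simp_all add: zero_padic_int.rep_eq one_padic_int.rep_eq
      plus_padic_int.rep_eq mod_simps algebra_simps)

lemma of_nat_padic_int_eq_0_iff: "(of_nat m :: 'p::prime_card padic_int) = 0 \<longleftrightarrow> m = 0"
proof
  let ?p = "CARD('p)"
  assume "(of_nat m :: 'p padic_int) = 0"
  hence "int m mod int ?p ^ m = 0"
    by (metis Rep_padic_int_of_nat zero_padic_int.rep_eq)
  hence "m mod ?p ^ m = 0"
    by (metis of_nat_eq_0_iff of_nat_power of_nat_mod)
  moreover have "m < ?p ^ m"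
    using prime_gt_1_nat[OF prime_card[where 'a = 'p]] by (simp add: power_gt_expt)
  ultimately show "m = 0" by simp
qed simp

instance padic_int :: (prime_card) ring_char_0
proof
  show "inj (of_nat :: nat \<Rightarrow> 'a padic_int)"
  proof (rule linorder_injI)
    fix x y :: nat assume "x < y"
    hence "(of_nat (y - x) :: 'a padic_int) \<noteq> 0"
      unfolding of_nat_padic_int_eq_0_iff by simp
    thus "(of_nat x :: 'a padic_int) \<noteq> of_nat y"
      using \<open>x < y\<close> by (metis of_nat_diff less_imp_le right_minus_eq)
  qed
qed

lemma is_unit_of_nat_padic_int:
  assumes "coprime m CARD('p::prime_card)"
  shows "(of_nat m :: 'p padic_int) dvd 1"
proof -
  let ?p = "int CARD('p)"
  have cop: "coprime (int m) (?p ^ n)" for n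
    using assms by simp
  define y where "y n = modular_inverse (?p ^ n) (int m) mod ?p ^ n" for n
  have y: "[int m * y n = 1] (mod ?p ^ n)" for n
    using cong_modular_inverse1[OF cop[of n]] by (simp add: y_def cong_def mod_simps)
  have "y (Suc n) mod ?p ^ n = y n" for n
  proof -
    have "[int m * y (Suc n) = 1] (mod ?p ^ n)"
      using y[of "Suc n"] by (rule cong_dvd_modulus) (simp add: le_imp_power_dvd)
    hence "[int m * y (Suc n) = int m * y n] (mod ?p ^ n)"
      using y[of n] cong_sym cong_trans by blast
    hence "[y (Suc n) = y n] (mod ?p ^ n)"
      using cop cong_mult_lcancel by blast
    thus ?thesis by (simp add: cong_def y_def)
  qed
  hence Y: "Rep_padic_int (Abs_padic_int y :: 'p padic_int) = y"
    by (intro Abs_padic_int_inverse) auto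
  have "of_nat m * (Abs_padic_int y :: 'p padic_int) = 1"
    by (rule Rep_padic_int_inject[THEN iffD1])
      (use y in \<open>auto simp: fun_eq_iff times_padic_int.rep_eq one_padic_int.rep_eq
        Rep_padic_int_of_nat Y mod_simps cong_def\<close>)
  thus ?thesis by (metis dvd_triv_left)
qed


section \<open>Polynomials in z, lambda and t\<close>

text \<open>
  \<open>\<rat>\<^sub>p\<close> is the fraction field of \<open>\<int>\<^sub>p\<close>.  A polynomial in the variables
  \<open>z\<^sub>0, z\<^sub>1, \<dots>\<close> is a finitely supported function on the monomials \<open>nat \<Rightarrow>\<^sub>0 nat\<close>
  (only \<open>z\<^sub>1, \<dots>, z\<^sub>2\<^sub>g\<^sub>+\<^sub>1\<close> are used below).  In an element of
  \<open>'p zpoly poly poly\<close> the inner polynomial variable is \<open>\<lambda>\<close> and the outer one is \<open>t\<close>.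
\<close>

type_synonym 'p padic = "'p padic_int fract"
type_synonym 'p zpoly = "(nat \<Rightarrow>\<^sub>0 nat) \<Rightarrow>\<^sub>0 'p padic"
type_synonym 'p zrat = "'p zpoly fract"

definition zconst :: "'a::zero \<Rightarrow> ((nat \<Rightarrow>\<^sub>0 nat) \<Rightarrow>\<^sub>0 'a)"
  where "zconst c = Poly_Mapping.single 0 c"

definition zvar :: "nat \<Rightarrow> ((nat \<Rightarrow>\<^sub>0 nat) \<Rightarrow>\<^sub>0 'a::zero_neq_one)"
  where "zvar i = Poly_Mapping.single (Poly_Mapping.single i 1) 1"

text \<open>The partial derivative with respect to \<open>z\<^sub>i\<close>.  In the monomials that do not contain
  \<open>z\<^sub>i\<close> the truncated subtraction is harmless, since the coefficient vanishes.\<close>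

definition zderiv :: "nat \<Rightarrow> ((nat \<Rightarrow>\<^sub>0 nat) \<Rightarrow>\<^sub>0 'a::comm_semiring_1) \<Rightarrow> ((nat \<Rightarrow>\<^sub>0 nat) \<Rightarrow>\<^sub>0 'a)"
  where "zderiv i f = (\<Sum>m\<in>Poly_Mapping.keys f.
    Poly_Mapping.single (m - Poly_Mapping.single i 1)
      (of_nat (Poly_Mapping.lookup m i) * Poly_Mapping.lookup f m))"

abbreviation cst3 :: "'a::comm_semiring_1 \<Rightarrow> ((nat \<Rightarrow>\<^sub>0 nat) \<Rightarrow>\<^sub>0 'a) poly poly"
  where "cst3 c \<equiv> [:[:zconst c:]:]"

abbreviation var_z :: "nat \<Rightarrow> ((nat \<Rightarrow>\<^sub>0 nat) \<Rightarrow>\<^sub>0 'a::comm_semiring_1) poly poly"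
  where "var_z i \<equiv> [:[:zvar i:]:]"

abbreviation var_lam :: "((nat \<Rightarrow>\<^sub>0 nat) \<Rightarrow>\<^sub>0 'a::comm_semiring_1) poly poly"
  where "var_lam \<equiv> [:[:0, 1:]:]"

abbreviation var_t :: "((nat \<Rightarrow>\<^sub>0 nat) \<Rightarrow>\<^sub>0 'a::comm_semiring_1) poly poly"
  where "var_t \<equiv> [:0, 1:]"


section \<open>The polynomials \<open>E\<^sub>s\<close>, \<open>\<Psi>\<^sub>s\<close> and \<open>I\<^sup>\<ell>\<close>\<close>

text \<open>Natural number division is the integer part of the quotient.\<close>

definition trunc_deg :: "nat \<Rightarrow> nat \<Rightarrow> nat"
  where "trunc_deg p s = s * (p - 1) div (p - 2) + 1"

definition trunc_exp :: "nat \<Rightarrow> 'p::prime_card padic poly"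
  where "trunc_exp s = (\<Sum>k=0..trunc_deg CARD('p) s. Polynomial.monom (1 / of_nat (fact k)) k)"

definition trunc_exp_plt :: "nat \<Rightarrow> 'p::prime_card zpoly poly poly"
  where "trunc_exp_plt s = poly (map_poly cst3 (trunc_exp s)) (of_nat CARD('p) * var_lam * var_t)"

text \<open>
  The factor \<open>1 / (t - z\<^sub>j)\<close> is cancelled against \<open>(t - z\<^sub>j) ^ ((p\<^sup>s - 1) / 2)\<close>,
  whose exponent is positive for \<open>p\<close> odd and \<open>s > 0\<close>; see \<open>master_times_diff\<close> below.
\<close>

definition master :: "nat \<Rightarrow> nat \<Rightarrow> nat \<Rightarrow> 'p::prime_card zpoly poly poly"
  where "master g s j = trunc_exp_plt s *
    (\<Prod>i\<in>{1..2*g+1}. (var_t - var_z i) ^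
       (if i = j then (CARD('p) ^ s - 1) div 2 - 1 else (CARD('p) ^ s - 1) div 2))"

definition Isol :: "nat \<Rightarrow> nat \<Rightarrow> nat \<Rightarrow> nat \<Rightarrow> 'p::prime_card zpoly poly"
  where "Isol g s l j = Polynomial.coeff (master g s j) (l * CARD('p) ^ s - 1)"

lemma prod_power_pred_times:
  fixes d :: "'b \<Rightarrow> 'a::comm_monoid_mult"
  assumes "finite A" "j \<in> A" "M > 0"
  shows "(\<Prod>i\<in>A. d i ^ (if i = j then M - 1 else M)) * d j = (\<Prod>i\<in>A. d i ^ M)"
proof -
  obtain k where k: "M = Suc k" using assms(3) by (cases M) auto
  have "(\<Prod>i\<in>A - {j}. d i ^ (if i = j then M - 1 else M)) = (\<Prod>i\<in>A - {j}. d i ^ M)"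
    by (intro prod.cong) auto
  thus ?thesis
    using prod.remove[OF assms(1,2), of "\<lambda>i. d i ^ (if i = j then M - 1 else M)"]
      prod.remove[OF assms(1,2), of "\<lambda>i. d i ^ M"]
    by (simp add: k mult_ac)
qed

lemma master_times_diff:
  assumes "odd CARD('p::prime_card)" "s > 0" "j \<in> {1..2*g+1}"
  shows "master g s j * (var_t - var_z j) =
    (trunc_exp_plt s :: 'p zpoly poly poly) *
      (\<Prod>i\<in>{1..2*g+1}. (var_t - var_z i) ^ ((CARD('p) ^ s - 1) div 2))"
proof -
  let ?M = "(CARD('p) ^ s - 1) div 2"
  let ?d = "\<lambda>i. var_t - var_z i :: 'p zpoly poly poly"
  have "CARD('p) \<noteq> 2" "CARD('p) > 1" using assms(1) prime_gt_1_nat[OF prime_card[where 'a='p]] by auto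
  hence "CARD('p) \<ge> 3" by simp
  moreover have "CARD('p) ^ 1 \<le> CARD('p) ^ s"
    using assms(2) by (intro power_increasing) auto
  ultimately have M: "?M > 0" by simp
  show ?thesis
    using prod_power_pred_times[of "{1..2*g+1}" j ?M ?d] assms(3) M
    by (simp only: master_def mult.assoc finite_atLeastAtMost)
qed


section \<open>Integrality\<close>

text \<open>The coefficients of \<open>E\<^sub>s(p\<lambda>t)\<close>, and hence of \<open>I\<^sup>\<ell>\<close>, lie in \<open>\<int>\<^sub>p\<close>.\<close>

definition zpoly_integral :: "'p::prime_card zpoly \<Rightarrow> bool"
  where "zpoly_integral f \<longleftrightarrow> (\<forall>m. Poly_Mapping.lookup f m \<in> range to_fract)"

definition poly_all :: "('a::zero \<Rightarrow> bool) \<Rightarrow> 'a poly \<Rightarrow> bool"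
  where "poly_all P f \<longleftrightarrow> (\<forall>n. P (Polynomial.coeff f n))"

definition subring_pred :: "('a::comm_ring_1 \<Rightarrow> bool) \<Rightarrow> bool"
  where "subring_pred P \<longleftrightarrow> P 0 \<and> P 1 \<and> (\<forall>x y. P x \<longrightarrow> P y \<longrightarrow> P (x + y) \<and> P (x * y)) \<and> (\<forall>x. P x \<longrightarrow> P (- x))"

lemma subring_pred_sum: "subring_pred P \<Longrightarrow> (\<And>x. x \<in> A \<Longrightarrow> P (f x)) \<Longrightarrow> P (sum f A)"
  by (induction A rule: infinite_finite_induct) (auto simp: subring_pred_def)

lemma subring_pred_prod: "subring_pred P \<Longrightarrow> (\<And>x. x \<in> A \<Longrightarrow> P (f x)) \<Longrightarrow> P (prod f A)"
  by (induction A rule: infinite_finite_induct) (auto simp: subring_pred_def)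

lemma subring_pred_power: "subring_pred P \<Longrightarrow> P x \<Longrightarrow> P (x ^ n)"
  by (induction n) (auto simp: subring_pred_def)

lemma subring_pred_poly_all:
  assumes "subring_pred P" shows "subring_pred (poly_all P)"
proof -
  have "P (\<Sum>i\<le>n. Polynomial.coeff x i * Polynomial.coeff y (n - i))" if "poly_all P x" "poly_all P y" for x y n
    using assms that by (intro subring_pred_sum[OF assms]) (auto simp: subring_pred_def poly_all_def)
  thus ?thesis using assms
    by (auto simp: subring_pred_def poly_all_def Polynomial.coeff_mult Polynomial.coeff_1)
qed

lemma subring_pred_zpoly_integral: "subring_pred (zpoly_integral :: 'p::prime_card zpoly \<Rightarrow> bool)"
proof -
  have range: "subring_pred (\<lambda>x :: 'p padic. x \<in> range to_fract)"
    unfolding subring_pred_def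
    by (auto simp flip: to_fract_add to_fract_mult to_fract_uminus to_fract_0 to_fract_1)
  have monomials: "f = (\<Sum>a\<in>Poly_Mapping.keys f. Poly_Mapping.single a (Poly_Mapping.lookup f a))"
    for f :: "'p zpoly"
    by (rule poly_mapping_eqI)
      (simp add: lookup_sum lookup_single when_def in_keys_iff)
  have m: "zpoly_integral (f * h)" if "zpoly_integral f" "zpoly_integral h" for f h :: "'p zpoly"
  proof -
    have "f * h = (\<Sum>a\<in>Poly_Mapping.keys f. Poly_Mapping.single a (Poly_Mapping.lookup f a)) *
        (\<Sum>b\<in>Poly_Mapping.keys h. Poly_Mapping.single b (Poly_Mapping.lookup h b))"
      by (intro arg_cong2[where f = times] monomials)
    hence fh: "f * h = (\<Sum>a\<in>Poly_Mapping.keys f. \<Sum>b\<in>Poly_Mapping.keys h.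
        Poly_Mapping.single (a + b) (Poly_Mapping.lookup f a * Poly_Mapping.lookup h b))"
      by (simp only: sum_product mult_single)
    show ?thesis unfolding zpoly_integral_def fh lookup_sum lookup_single
      using range that
      by (auto intro!: subring_pred_sum[OF range] simp: zpoly_integral_def subring_pred_def when_def)
  qed
  show ?thesis using range m
    unfolding subring_pred_def zpoly_integral_def
    by (auto simp: lookup_add lookup_one when_def)
qed

lemma fact_eq_prime_power_times:
  assumes "prime (p :: nat)"
  shows "\<exists>m. coprime m p \<and> fact k = p ^ (k div p) * fact (k div p) * m"
proof (induction k)
  case 0
  show ?case by (rule exI[of _ 1]) simp
next
  case (Suc k)
  then obtain m where m: "coprime m p" "fact k = p ^ (k div p) * fact (k div p) * m" by blast
  show ?case
  proof (cases "p dvd Suc k")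
    case True
    hence d: "Suc k div p = Suc (k div p)" by (simp add: div_Suc dvd_eq_mod_eq_0)
    have "Suc k = p * Suc (k div p)" using True d by (metis dvd_mult_div_cancel)
    moreover have "(fact (Suc k) :: nat) = Suc k * fact k" by (simp only: fact_Suc of_nat_id)
    ultimately have "fact (Suc k) = p * Suc (k div p) * (p ^ (k div p) * fact (k div p) * m)"
      using m(2) by metis
    also have "\<dots> = p ^ Suc (k div p) * fact (Suc (k div p)) * m"
      by (simp only: fact_Suc power_Suc of_nat_id mult_ac)
    finally show ?thesis using m(1) d by metis
  next
    case False
    hence d: "Suc k div p = k div p" by (simp add: div_Suc dvd_eq_mod_eq_0)
    have "coprime (m * Suc k) p"
      using m(1) False assms prime_imp_coprime[of p "Suc k"] by (metis coprime_commute coprime_mult_left_iff)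
    moreover have "fact (Suc k) = p ^ (k div p) * fact (k div p) * (m * Suc k)"
      using m(2) by (simp only: fact_Suc of_nat_id mult_ac)
    ultimately show ?thesis using d by metis
  qed
qed

lemma fact_eq_prime_power_times':
  assumes "prime (p :: nat)"
  shows "\<exists>m v. coprime m p \<and> v \<le> k \<and> fact k = p ^ v * m"
proof (induction k rule: less_induct)
  case (less k)
  show ?case
  proof (cases "k = 0")
    case True
    show ?thesis by (rule exI[of _ 1], rule exI[of _ 0]) (simp add: True)
  next
    case False
    have p: "p \<ge> 2" using assms by (rule prime_ge_2_nat)
    hence "k div p < k" using False by simp
    with less obtain m v where m: "coprime m p" "v \<le> k div p" "fact (k div p) = p ^ v * m"
      by blast
    obtain m' where m': "coprime m' p" "fact k = p ^ (k div p) * fact (k div p) * m'"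
      using fact_eq_prime_power_times[OF assms] by blast
    have "k div p * 2 \<le> k div p * p" using p by (intro mult_left_mono) auto
    also have "\<dots> \<le> k" by (rule div_times_less_eq_dividend)
    finally have "k div p + v \<le> k" using m(2) by linarith
    moreover have "fact k = p ^ (k div p + v) * (m * m')"
      using m'(2) m(3) by (simp add: power_add)
    moreover have "coprime (m * m') p" using m(1) m'(1) by simp
    ultimately show ?thesis by blast
  qed
qed

lemma of_nat_fract: "(of_nat n :: 'a::idom fract) = to_fract (of_nat n)"
  by (induction n) simp_all

lemma power_over_fact_integral:
  "(of_nat CARD('p) ^ k / of_nat (fact k) :: 'p::prime_card padic) \<in> range to_fract"
proof -
  obtain m v where m: "coprime m CARD('p)" "v \<le> k" "fact k = CARD('p) ^ v * m"
    using fact_eq_prime_power_times'[OF prime_card] by blast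
  from is_unit_of_nat_padic_int[OF m(1)] obtain u :: "'p padic_int" where u: "1 = of_nat m * u"
    by (elim dvdE)
  define q :: "'p padic" where "q = of_nat CARD('p)"
  have q: "q \<noteq> 0" unfolding q_def of_nat_fract by simp
  have mu: "of_nat m * to_fract u = (1 :: 'p padic)"
    unfolding of_nat_fract by (simp flip: to_fract_mult u)
  hence m0: "(of_nat m :: 'p padic) \<noteq> 0" by auto
  have "q ^ k / of_nat (fact k) = q ^ (k - v) * q ^ v / (q ^ v * of_nat m)"
    using m(2) unfolding m(3) by (simp add: q_def flip: power_add)
  also have "\<dots> = q ^ (k - v) * to_fract u"
    using q m0 mu by (simp add: field_simps)
  also have "\<dots> = to_fract (of_nat (CARD('p) ^ (k - v)) * u)"
    by (simp only: q_def to_fract_mult of_nat_fract[symmetric]) (simp only: of_nat_power)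
  finally show ?thesis unfolding q_def by blast
qed

lemma cst3_mult: "cst3 (a * b) = cst3 a * (cst3 b :: 'p::prime_card zpoly poly poly)"
  by (simp add: zconst_def mult_single)

lemma cst3_of_nat: "cst3 (of_nat n) = (of_nat n :: 'p::prime_card zpoly poly poly)"
  by (simp add: zconst_def of_nat_poly)

lemma trunc_exp_plt_eq:
  "(trunc_exp_plt s :: 'p::prime_card zpoly poly poly) =
     (\<Sum>k=0..trunc_deg CARD('p) s.
        cst3 (of_nat CARD('p) ^ k / of_nat (fact k)) * (var_lam * var_t) ^ k)"
proof -
  let ?E = "trunc_exp s :: 'p padic poly" and ?d = "trunc_deg CARD('p) s"
  let ?x = "of_nat CARD('p) * var_lam * var_t :: 'p zpoly poly poly"
  let ?c = "cst3 :: 'p padic \<Rightarrow> 'p zpoly poly poly"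
  have c0: "?c 0 = 0" by (simp add: zconst_def)
  have coeff: "Polynomial.coeff ?E k = (if k \<le> ?d then 1 / of_nat (fact k) else 0)" for k
    by (simp add: trunc_exp_def Polynomial.coeff_sum)
  have deg: "Polynomial.degree (map_poly ?c ?E) \<le> ?d"
    by (rule Polynomial.degree_le) (simp add: coeff_map_poly[of ?c, OF c0] coeff c0)
  have pow: "?c (of_nat CARD('p) ^ k) = of_nat CARD('p) ^ k" for k
    using cst3_of_nat[of "CARD('p) ^ k"] by (simp only: of_nat_power)
  have "trunc_exp_plt s = (\<Sum>k\<le>?d. Polynomial.coeff (map_poly ?c ?E) k * ?x ^ k)"
    unfolding trunc_exp_plt_def poly_altdef
    by (rule sum.mono_neutral_left) (use deg in \<open>auto simp: Polynomial.coeff_eq_0\<close>)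
  also have "\<dots> = (\<Sum>k\<le>?d. ?c (of_nat CARD('p) ^ k / of_nat (fact k)) * (var_lam * var_t) ^ k)"
  proof (rule sum.cong[OF refl])
    fix k assume "k \<in> {..?d}"
    hence "Polynomial.coeff (map_poly ?c ?E) k = ?c (1 / of_nat (fact k))"
      by (simp only: coeff_map_poly[of ?c, OF c0] coeff atMost_iff if_True)
    moreover have "?c (of_nat CARD('p) ^ k / of_nat (fact k))
        = ?c (of_nat CARD('p) ^ k) * ?c (1 / of_nat (fact k))"
      by (simp only: cst3_mult[symmetric] times_divide_eq_right mult_1_right)
    ultimately show "Polynomial.coeff (map_poly ?c ?E) k * ?x ^ k
        = ?c (of_nat CARD('p) ^ k / of_nat (fact k)) * (var_lam * var_t) ^ k"
      by (simp only: pow power_mult_distrib mult_ac)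
  qed
  finally show ?thesis by (simp only: atLeast0AtMost)
qed

lemma Isol_integral: "poly_all zpoly_integral (Isol g s l j :: 'p::prime_card zpoly poly)"
proof -
  let ?Q = "poly_all (poly_all (zpoly_integral :: 'p zpoly \<Rightarrow> bool))"
  have Q: "subring_pred ?Q"
    by (intro subring_pred_poly_all subring_pred_zpoly_integral)
  have diff: "?Q (a - b)" if "?Q a" "?Q b" for a b
    using Q that unfolding subring_pred_def by (metis diff_conv_add_uminus)
  have times: "?Q (a * b)" if "?Q a" "?Q b" for a b
    using Q that unfolding subring_pred_def by blast
  have r0: "(0 :: 'p padic) \<in> range to_fract" "(1 :: 'p padic) \<in> range to_fract"
    by (metis to_fract_0 rangeI, metis to_fract_1 rangeI)
  have zero: "zpoly_integral 0" and one: "zpoly_integral 1"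
    using subring_pred_zpoly_integral unfolding subring_pred_def by blast+
  have const: "?Q [:[:c:]:]" if "zpoly_integral c" for c
    using that zero by (auto simp: poly_all_def Polynomial.coeff_pCons split: nat.split)
  have lam: "?Q var_lam" and t: "?Q var_t"
    using zero one by (auto simp: poly_all_def Polynomial.coeff_pCons split: nat.split)
  have z: "?Q (var_z i)" for i
    by (rule const) (use r0 in \<open>auto simp: zpoly_integral_def zvar_def lookup_single when_def\<close>)
  have E: "?Q (trunc_exp_plt s)"
    unfolding trunc_exp_plt_eq
  proof (intro subring_pred_sum[OF Q] times subring_pred_power[OF Q] lam t const)
    show "zpoly_integral (zconst (of_nat CARD('p) ^ k / of_nat (fact k) :: 'p padic))" for k
      using r0 power_over_fact_integral[where 'p = 'p]
      by (auto simp: zpoly_integral_def zconst_def lookup_single when_def)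
  qed
  have "?Q (master g s j)"
    unfolding master_def
    by (intro times E subring_pred_prod[OF Q] subring_pred_power[OF Q] diff t z)
  thus ?thesis by (simp add: poly_all_def Isol_def)
qed


section \<open>Solutions modulo \<open>p\<^sup>s\<close>\<close>

text \<open>The ring \<open>R = \<int>\<^sub>p[z\<^sub>1, \<dots>, z\<^sub>2\<^sub>g\<^sub>+\<^sub>1][(z\<^sub>i - z\<^sub>j)\<^sup>-\<^sup>1, i \<noteq> j]\<close> as the subring
  generated by the elements shown inside the field \<open>\<rat>\<^sub>p(z)\<close>; negatives come from the constants.\<close>

inductive_set zring :: "nat \<Rightarrow> 'p::prime_card zrat set" for g :: nat
  where
    const: "to_fract (zconst (to_fract c)) \<in> zring g"
  | var: "i \<in> {1..2*g+1} \<Longrightarrow> to_fract (zvar i) \<in> zring g"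
  | inv: "i \<in> {1..2*g+1} \<Longrightarrow> j \<in> {1..2*g+1} \<Longrightarrow> i \<noteq> j \<Longrightarrow>
      inverse (to_fract (zvar i) - to_fract (zvar j)) \<in> zring g"
  | add: "x \<in> zring g \<Longrightarrow> y \<in> zring g \<Longrightarrow> x + y \<in> zring g"
  | mult: "x \<in> zring g \<Longrightarrow> y \<in> zring g \<Longrightarrow> x * y \<in> zring g"

definition zcong :: "nat \<Rightarrow> nat \<Rightarrow> 'p::prime_card zrat \<Rightarrow> 'p zrat \<Rightarrow> bool"
  where "zcong g s x y \<longleftrightarrow> (\<exists>r\<in>zring g. x - y = of_nat CARD('p) ^ s * r)"

definition lamval :: "'p::prime_card padic_int \<Rightarrow> 'p zrat"
  where "lamval lam = to_fract (zconst (to_fract lam))"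

definition at_lam :: "'p::prime_card padic_int \<Rightarrow> 'p zpoly poly \<Rightarrow> 'p zrat"
  where "at_lam lam F = to_fract (poly F (zconst (to_fract lam)))"

text \<open>Derivatives are taken in \<open>\<rat>\<^sub>p[z][\<lambda>]\<close>, with respect to \<open>z\<^sub>i\<close> coefficientwise and with
  respect to \<open>\<lambda>\<close> by \<^const>\<open>pderiv\<close>, before the value of \<open>\<lambda>\<close> is substituted.\<close>

definition KZ_solution_mod ::
    "nat \<Rightarrow> nat \<Rightarrow> 'p::prime_card padic_int \<Rightarrow> (nat \<Rightarrow> 'p zpoly poly) \<Rightarrow> bool"
  where "KZ_solution_mod g s lam I \<longleftrightarrow>
    (\<forall>i\<in>{1..2*g+1}. \<forall>j\<in>{1..2*g+1}. i \<noteq> j \<longrightarrow>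
       zcong g s (at_lam lam (map_poly (zderiv i) (I j)))
         (1 / 2 * ((at_lam lam (I i) - at_lam lam (I j)) /
            (to_fract (zvar i) - to_fract (zvar j))))) \<and>
    (\<forall>i\<in>{1..2*g+1}.
       zcong g s (at_lam lam (map_poly (zderiv i) (I i)))
         (of_nat CARD('p) * lamval lam * at_lam lam (I i) -
          1 / 2 * (\<Sum>j\<in>{1..2*g+1} - {i}. (at_lam lam (I i) - at_lam lam (I j)) /
            (to_fract (zvar i) - to_fract (zvar j)))))"

definition dynamical_solution_mod ::
    "nat \<Rightarrow> nat \<Rightarrow> 'p::prime_card padic_int \<Rightarrow> (nat \<Rightarrow> 'p zpoly poly) \<Rightarrow> bool"
  where "dynamical_solution_mod g s lam I \<longleftrightarrow>
    (\<forall>i\<in>{1..2*g+1}.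
       zcong g s (at_lam lam (pderiv (I i)))
         (of_nat CARD('p) * to_fract (zvar i) * at_lam lam (I i) +
          1 / (2 * lamval lam) * (\<Sum>j\<in>{1..2*g+1}. at_lam lam (I j))))"

end

theory Submission
  imports Defs
begin

text \<open>
  Write \<open>M = (p\<^sup>s - 1) / 2\<close>, \<open>\<Phi> = E\<^sub>s(p\<lambda>t) \<Prod>\<^sub>k (t - z\<^sub>k)\<^sup>M\<close> and
  \<open>\<Psi>\<^sub>j = \<Phi> / (t - z\<^sub>j)\<close>.  Since \<open>M \<equiv> - 1/2\<close>, differentiating \<open>\<Psi>\<^sub>j\<close> by
  \<open>\<partial>/\<partial>z\<^sub>i\<close> (for \<open>i \<noteq> j\<close>), by \<open>\<partial>/\<partial>z\<^sub>j + \<partial>/\<partial>t\<close> and by \<open>\<lambda> \<partial>/\<partial>\<lambda>\<close> gives the three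
  equations modulo \<open>p\<^sup>s\<close> up to a \<open>t\<close>-derivative (of \<open>\<Psi>\<^sub>j\<close> or of \<open>\<Phi>\<close>), whose coefficient at
  \<open>t\<^bsup>l p\<^sup>s - 1\<^esup>\<close> is divisible by \<open>p\<^sup>s\<close>.  The choice of \<open>d = d(s)\<close> makes
  \<open>\<partial>E\<^sub>s(p\<lambda>t)/\<partial>t \<equiv> p\<lambda> E\<^sub>s(p\<lambda>t)\<close>: the missing top term is a multiple of \<open>p\<^sup>d / d!\<close>, and
  \<open>v\<^sub>p(d!) \<le> d / (p - 1) < d - s\<close>.
\<close>

section \<open>Derivations\<close>

text \<open>Additivity and the product rule are what the derivatives along z_i, \<lambda>, t and
  their sums share, so one computation can serve all three equations.\<close>

definition derivation :: "('a::comm_ring_1 \<Rightarrow> 'a) \<Rightarrow> bool"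
  where "derivation D \<longleftrightarrow> (\<forall>x y. D (x + y) = D x + D y) \<and> (\<forall>x y. D (x * y) = D x * y + x * D y)"

lemma derivation_add: "derivation D \<Longrightarrow> D (x + y) = D x + D y"
  and derivation_mult: "derivation D \<Longrightarrow> D (x * y) = D x * y + x * D y"
  by (simp_all add: derivation_def)

lemma derivation_0: "derivation D \<Longrightarrow> D 0 = 0"
  using derivation_add[of D 0 0] by simp

lemma derivation_1: "derivation D \<Longrightarrow> D 1 = 0"
  using derivation_mult[of D 1 1] by simp

lemma derivation_uminus: "derivation D \<Longrightarrow> D (- x) = - D x"
  using derivation_add[of D x "- x"] by (simp add: derivation_0 eq_neg_iff_add_eq_0 add.commute)

lemma derivation_diff: "derivation D \<Longrightarrow> D (x - y) = D x - D y"
  using derivation_add[of D x "- y"] by (simp add: derivation_uminus)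

lemma derivation_sum: "derivation D \<Longrightarrow> D (sum f A) = (\<Sum>x\<in>A. D (f x))"
  by (induction A rule: infinite_finite_induct) (simp_all add: derivation_0 derivation_add)

lemma derivation_power: "derivation D \<Longrightarrow> D (x ^ n) = of_nat n * x ^ (n - 1) * D x"
proof (induction n)
  case (Suc n)
  then show ?case
    by (cases n) (simp_all add: derivation_1 derivation_mult algebra_simps)
qed (simp add: derivation_1)

lemma derivation_prod:
  assumes "derivation D" "finite A"
  shows "D (prod f A) = (\<Sum>k\<in>A. D (f k) * prod f (A - {k}))"
  using assms(2)
proof (induction A rule: finite_induct)
  case (insert a A)
  have "(\<Sum>k\<in>A. D (f k) * prod f (insert a A - {k})) = (\<Sum>k\<in>A. f a * (D (f k) * prod f (A - {k})))"
  proof (rule sum.cong[OF refl])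
    fix k assume "k \<in> A"
    hence "insert a A - {k} = insert a (A - {k})" using insert.hyps by auto
    thus "D (f k) * prod f (insert a A - {k}) = f a * (D (f k) * prod f (A - {k}))"
      using insert.hyps by (simp add: mult_ac)
  qed
  moreover have "insert a A - {a} = A" using insert.hyps by auto
  ultimately show ?case
    using insert by (simp add: derivation_mult[OF assms(1)] sum_distrib_left)
qed (simp add: derivation_1[OF assms(1)])

lemma derivation_plus: "derivation D \<Longrightarrow> derivation D' \<Longrightarrow> derivation (\<lambda>x. D x + D' x)"
  by (simp add: derivation_def algebra_simps)

lemma derivation_pderiv: "derivation (pderiv :: 'a::idom poly \<Rightarrow> 'a poly)"
  by (simp add: derivation_def pderiv_add pderiv_mult algebra_simps)

text \<open>Lifting \<open>zderiv i\<close> twice and \<open>pderiv\<close> once gives the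
  derivatives along z_i and along \<lambda> on \<open>zpoly poly poly\<close>, where t is the outer
  variable.\<close>

lemma derivation_map_poly:
  assumes "derivation D" shows "derivation (map_poly D)"
proof -
  note D0 = derivation_0[OF assms]
  have "map_poly D (x * y) = map_poly D x * y + x * map_poly D y" for x y
    by (rule poly_eqI)
      (simp add: coeff_map_poly[of D, OF D0] Polynomial.coeff_mult derivation_sum[OF assms]
        derivation_mult[OF assms] sum.distrib)
  moreover have "map_poly D (x + y) = map_poly D x + map_poly D y" for x y
    by (rule poly_eqI) (simp add: coeff_map_poly[of D, OF D0] derivation_add[OF assms])
  ultimately show ?thesis by (simp add: derivation_def)
qed

lemma map_poly_derivation_const: "derivation D \<Longrightarrow> map_poly D [:c:] = [:D c:]"
  by (rule poly_eqI) (simp add: coeff_map_poly derivation_0 Polynomial.coeff_pCons split: nat.split)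

lemma map_poly_derivation_X: "derivation D \<Longrightarrow> map_poly D [:0, 1:] = 0"
  by (rule poly_eqI)
    (simp add: coeff_map_poly derivation_0 derivation_1 Polynomial.coeff_pCons split: nat.split)

section \<open>Partial derivatives along z_i\<close>

lemma zderiv_single:
  "zderiv i (Poly_Mapping.single a x) =
     Poly_Mapping.single (a - Poly_Mapping.single i 1) (of_nat (Poly_Mapping.lookup a i) * x)"
  by (cases "x = 0") (simp_all add: zderiv_def)

text \<open>Knowing the coefficients removes the dependence of \<open>zderiv_def\<close> on the
  support of \<open>f\<close>, so additivity can be checked coefficient by coefficient.\<close>

lemma lookup_zderiv:
  "Poly_Mapping.lookup (zderiv i f) m =
     of_nat (Poly_Mapping.lookup m i + 1) * Poly_Mapping.lookup f (m + Poly_Mapping.single i 1)"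
proof -
  let ?e = "Poly_Mapping.single i (1::nat)"
  \<comment> \<open>The two conditions on \<open>k\<close> can differ only for monomials without
    z_i, where the factor \<open>of_nat 0\<close> makes both sides vanish. The sum over
    \<open>k\<close> is then left with one possible term.\<close>
  have eq: "(of_nat (Poly_Mapping.lookup k i) * Poly_Mapping.lookup f k when k - ?e = m) =
      (of_nat (Poly_Mapping.lookup k i) * Poly_Mapping.lookup f k when k = m + ?e)" for k
  proof (cases "Poly_Mapping.lookup k i = 0")
    case False
    have "k - ?e = m \<longleftrightarrow> k = m + ?e"
    proof
      assume "k - ?e = m"
      hence "m + ?e = k"
        using False by (intro poly_mapping_eqI)
          (auto simp: lookup_add lookup_minus lookup_single when_def)
      thus "k = m + ?e" ..
    qed simp
    thus ?thesis by simp
  qed (simp add: when_def)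
  show ?thesis
    unfolding zderiv_def lookup_sum lookup_single eq
    by (auto simp: when_def in_keys_iff lookup_add)
qed

lemma poly_mapping_eq_sum_single:
  "f = (\<Sum>a\<in>Poly_Mapping.keys f. Poly_Mapping.single a (Poly_Mapping.lookup f a))"
  by (rule poly_mapping_eqI) (simp add: lookup_sum lookup_single when_def in_keys_iff)

lemma zderiv_add: "zderiv i (f + h) = zderiv i f + zderiv i h"
  by (rule poly_mapping_eqI) (simp add: lookup_zderiv lookup_add algebra_simps)

lemma zderiv_sum: "zderiv i (sum f A) = (\<Sum>x\<in>A. zderiv i (f x))"
  by (induction A rule: infinite_finite_induct) (simp_all add: zderiv_add, simp_all add: zderiv_def)

lemma zderiv_mult_single:
  fixes x y :: "'a::comm_semiring_1"
  shows "zderiv i (Poly_Mapping.single a x * Poly_Mapping.single b y) =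
    zderiv i (Poly_Mapping.single a x) * Poly_Mapping.single b y +
    Poly_Mapping.single a x * zderiv i (Poly_Mapping.single b y)"
proof -
  let ?e = "Poly_Mapping.single i (1::nat)"
  \<comment> \<open>Truncated subtraction commutes with adding \<open>b\<close> when z_i occurs in
    \<open>a\<close>; when it does not, the derivative of that monomial has coefficient
    zero.\<close>
  have "a - ?e + b = a + b - ?e" if "Poly_Mapping.lookup a i \<noteq> 0"
    using that by (intro poly_mapping_eqI)
      (auto simp: lookup_add lookup_minus lookup_single when_def)
  moreover have "a + (b - ?e) = a + b - ?e" if "Poly_Mapping.lookup b i \<noteq> 0"
    using that by (intro poly_mapping_eqI)
      (auto simp: lookup_add lookup_minus lookup_single when_def)
  ultimately show ?thesis
    by (cases "Poly_Mapping.lookup a i = 0"; cases "Poly_Mapping.lookup b i = 0")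
      (simp_all add: mult_single zderiv_single lookup_add algebra_simps flip: single_add)
qed

text \<open>Both factors are sums of monomials, so by bilinearity the product rule reduces to
  \<open>zderiv_mult_single\<close>.\<close>

lemma derivation_zderiv:
  "derivation (zderiv i :: ((nat \<Rightarrow>\<^sub>0 nat) \<Rightarrow>\<^sub>0 'a::comm_ring_1) \<Rightarrow> _)"
proof -
  have "zderiv i (f * h) = zderiv i f * h + f * zderiv i h"
    for f h :: "(nat \<Rightarrow>\<^sub>0 nat) \<Rightarrow>\<^sub>0 'a"
  proof -
    let ?F = "\<lambda>a. Poly_Mapping.single a (Poly_Mapping.lookup f a)"
    let ?H = "\<lambda>a. Poly_Mapping.single a (Poly_Mapping.lookup h a)"
    have "zderiv i (sum ?F (Poly_Mapping.keys f) * sum ?H (Poly_Mapping.keys h)) =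
        zderiv i (sum ?F (Poly_Mapping.keys f)) * sum ?H (Poly_Mapping.keys h) +
        sum ?F (Poly_Mapping.keys f) * zderiv i (sum ?H (Poly_Mapping.keys h))"
      by (simp only: sum_product zderiv_sum zderiv_mult_single sum.distrib)
    thus ?thesis by (simp only: poly_mapping_eq_sum_single[symmetric])
  qed
  thus ?thesis by (simp add: derivation_def zderiv_add)
qed

lemma zderiv_zvar: "zderiv i (zvar k :: (nat \<Rightarrow>\<^sub>0 nat) \<Rightarrow>\<^sub>0 'a::comm_ring_1) = (if i = k then 1 else 0)"
  by (auto simp: zvar_def zderiv_single lookup_single)

lemma zderiv_zconst: "zderiv i (zconst c) = 0"
  by (simp add: zconst_def zderiv_single)


section \<open>Products of powers with reduced exponents\<close>

text \<open>For \<open>B \<subseteq> A\<close> and \<open>M > 0\<close> this is the product of all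
  \<open>d k ^ M\<close> divided by the \<open>d k\<close> with \<open>k\<close> in
  \<open>B\<close>, written without division. Up to the factor \<open>E\<close>, the empty
  \<open>B\<close> gives \<Phi> and \<open>{j}\<close> gives \<Psi>_j; pairs appear in their
  derivatives.\<close>

definition reduced_prod :: "'b set \<Rightarrow> ('b \<Rightarrow> 'a::comm_monoid_mult) \<Rightarrow> nat \<Rightarrow> 'b set \<Rightarrow> 'a"
  where "reduced_prod A d M B = (\<Prod>k\<in>A. d k ^ (if k \<in> B then M - 1 else M))"

lemma reduced_prod_insert:
  assumes "finite A" "j \<in> A" "j \<notin> B" "M > 0"
  shows "reduced_prod A d M (insert j B) * d j = reduced_prod A d M B"
proof -
  obtain m where m: "M = Suc m" using assms(4) by (cases M) auto
  have "(\<Prod>k\<in>A - {j}. d k ^ (if k \<in> insert j B then M - 1 else M)) =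
      (\<Prod>k\<in>A - {j}. d k ^ (if k \<in> B then M - 1 else M))"
    by (intro prod.cong) auto
  thus ?thesis
    using assms unfolding reduced_prod_def
      prod.remove[OF assms(1,2), of "\<lambda>k. d k ^ (if k \<in> insert j B then M - 1 else M)"]
      prod.remove[OF assms(1,2), of "\<lambda>k. d k ^ (if k \<in> B then M - 1 else M)"]
    by (simp add: m mult_ac)
qed

lemma derivation_reduced_prod_empty:
  assumes "derivation D" "finite A"
  shows "D (reduced_prod A d M {}) = of_nat M * (\<Sum>k\<in>A. D (d k) * reduced_prod A d M {k})"
proof -
  have "reduced_prod A d M {k} = d k ^ (M - 1) * (\<Prod>i\<in>A - {k}. d i ^ M)" if "k \<in> A" for k
  proof -
    have "(\<Prod>i\<in>A - {k}. d i ^ (if i \<in> {k} then M - 1 else M)) = (\<Prod>i\<in>A - {k}. d i ^ M)"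
      by (intro prod.cong) auto
    thus ?thesis
      by (simp add: reduced_prod_def prod.remove[OF assms(2) that])
  qed
  thus ?thesis
    using derivation_prod[OF assms, of "\<lambda>k. d k ^ M"]
    by (simp add: reduced_prod_def[of A d M "{}"] derivation_power[OF assms(1)]
        sum_distrib_left mult_ac)
qed

text \<open>All three differential equations are instances of the following identity: the choice of
  \<open>D\<close> with \<open>D (d j) = 0\<close> avoids the square of \<open>d j\<close> in the denominator.\<close>

lemma derivation_times_reduced_prod:
  fixes d :: "'b \<Rightarrow> 'a::idom"
  assumes D: "derivation D" and A: "finite A" "j \<in> A" and "M > 0" "d j \<noteq> 0" "D (d j) = 0"
  shows "D (E * reduced_prod A d M {j}) = D E * reduced_prod A d M {j} +
    of_nat M * (\<Sum>k\<in>A - {j}. D (d k) * (E * reduced_prod A d M {k, j}))"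
proof -
  let ?W = "reduced_prod A d M"
  have Wj: "?W {j} * d j = ?W {}"
    using assms by (intro reduced_prod_insert) auto
  \<comment> \<open>Multiplying by \<open>d j\<close>, on which \<open>D\<close> vanishes, restores
    the full product, to which the power rule applies. The term \<open>k = j\<close> drops out and
    every other term keeps a factor \<open>d j\<close>, which is cancelled at the end.\<close>
  have "D (E * ?W {j}) * d j = D (E * ?W {j} * d j)"
    using assms(6) by (simp add: derivation_mult[OF D])
  also have "\<dots> = D (E * ?W {})" by (simp add: Wj mult.assoc)
  also have "\<dots> = D E * ?W {} + E * (of_nat M * (\<Sum>k\<in>A. D (d k) * ?W {k}))"
    by (simp add: derivation_mult[OF D] derivation_reduced_prod_empty[OF D A(1)])
  also have "(\<Sum>k\<in>A. D (d k) * ?W {k}) = (\<Sum>k\<in>A - {j}. D (d k) * ?W {k})"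
    using assms(6) by (simp add: sum.remove[OF A])
  also have "\<dots> = (\<Sum>k\<in>A - {j}. D (d k) * (?W {k, j} * d j))"
  proof (rule sum.cong[OF refl])
    fix k assume "k \<in> A - {j}"
    hence "?W (insert j {k}) * d j = ?W {k}"
      using assms by (intro reduced_prod_insert) auto
    thus "D (d k) * ?W {k} = D (d k) * (?W {k, j} * d j)" by (simp add: insert_commute)
  qed
  also have "D E * ?W {} + E * (of_nat M * \<dots>) =
      (D E * ?W {j} + of_nat M * (\<Sum>k\<in>A - {j}. D (d k) * (E * ?W {k, j}))) * d j"
    by (simp add: Wj[symmetric] algebra_simps sum_distrib_left)
  finally show ?thesis using assms(5) by simp
qed


section \<open>The \<open>t\<close>-derivative of the truncated exponential\<close>

text \<open>Legendre's bound v_p(k!) \<le> k / (p - 1), by induction along \<open>k div p\<close>: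
  the multiples of \<open>p\<close> up to \<open>k\<close> contribute \<open>k div p\<close> plus
  the valuation of \<open>fact (k div p)\<close>.\<close>

lemma fact_eq_prime_power_times_bound:
  assumes "prime (p :: nat)"
  shows "\<exists>m v. coprime m p \<and> v * (p - 1) \<le> k \<and> fact k = p ^ v * m"
proof (induction k rule: less_induct)
  case (less k)
  show ?case
  proof (cases "k = 0")
    case True
    show ?thesis by (rule exI[of _ 1], rule exI[of _ 0]) (simp add: True)
  next
    case False
    have p: "p \<ge> 2" using assms by (rule prime_ge_2_nat)
    hence "k div p < k" using False by simp
    with less obtain m v where m: "coprime m p" "v * (p - 1) \<le> k div p" "fact (k div p) = p ^ v * m"
      by blast
    obtain m' where m': "coprime m' p" "fact k = p ^ (k div p) * fact (k div p) * m'"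
      using fact_eq_prime_power_times[OF assms] by blast
    have "(k div p + v) * (p - 1) \<le> k div p * (p - 1) + k div p"
      using m(2) by (simp add: add_mult_distrib)
    also have "\<dots> = k div p * p"
      using p by (cases p) auto
    also have "\<dots> \<le> k" by (rule div_times_less_eq_dividend)
    finally have "(k div p + v) * (p - 1) \<le> k" .
    moreover have "fact k = p ^ (k div p + v) * (m * m')"
      using m'(2) m(3) by (simp add: power_add)
    moreover have "coprime (m * m') p" using m(1) m'(1) by simp
    ultimately show ?thesis by blast
  qed
qed

text \<open>Here d(s) is the least integer d with s (p - 1) < d (p - 2). Adding v (p - 1) \<le> d
  gives (s + v) (p - 1) < d (p - 1).\<close>

lemma trunc_deg_bound:
  assumes "p \<ge> 3" "v * (p - 1) \<le> trunc_deg p s"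
  shows "s + v \<le> trunc_deg p s"
proof -
  let ?d = "trunc_deg p s"
  have "s * (p - 1) < ?d * (p - 2)"
    using dividend_less_div_times[of "p - 2" "s * (p - 1)"] assms(1)
    by (simp add: trunc_deg_def add_mult_distrib)
  moreover have "?d * (p - 1) = ?d * (p - 2) + ?d"
    using assms(1) by (metis Suc_diff_le add.commute diff_Suc_Suc mult_Suc_right numeral_2_eq_2
        numeral_3_eq_3 Suc_leD One_nat_def)
  ultimately have "(s + v) * (p - 1) < ?d * (p - 1)"
    using assms(2) by (simp add: add_mult_distrib)
  thus ?thesis by simp
qed

lemma odd_prime_card_ge_3:
  assumes "odd CARD('p::prime_card)" shows "CARD('p) \<ge> 3"
proof -
  have "CARD('p) \<noteq> 2" "CARD('p) > 1"
    using assms prime_gt_1_nat[OF prime_card[where 'a='p]] by auto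
  thus ?thesis by simp
qed

lemma power_trunc_deg_over_fact:
  assumes "odd CARD('p::prime_card)"
  shows "\<exists>u. (of_nat CARD('p) ^ trunc_deg CARD('p) s / of_nat (fact (trunc_deg CARD('p) s)) :: 'p padic)
    = of_nat CARD('p) ^ s * to_fract u"
proof -
  let ?d = "trunc_deg CARD('p) s"
  obtain m v where m: "coprime m CARD('p)" "v * (CARD('p) - 1) \<le> ?d" "fact ?d = CARD('p) ^ v * m"
    using fact_eq_prime_power_times_bound[OF prime_card] by blast
  have sv: "s + v \<le> ?d"
    using trunc_deg_bound[OF odd_prime_card_ge_3[OF assms] m(2)] .
  from is_unit_of_nat_padic_int[OF m(1)] obtain u :: "'p padic_int" where u: "1 = of_nat m * u"
    by (elim dvdE)
  define q :: "'p padic" where "q = of_nat CARD('p)"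
  have q: "q \<noteq> 0" unfolding q_def of_nat_fract by simp
  have mu: "of_nat m * to_fract u = (1 :: 'p padic)"
    unfolding of_nat_fract by (simp flip: to_fract_mult u)
  hence m0: "(of_nat m :: 'p padic) \<noteq> 0" by auto
  \<comment> \<open>The exponent is split so that \<open>q ^ v\<close> cancels against the factorial
    while \<open>q ^ s\<close> survives; the prime-to-p part \<open>m\<close> is inverted by
    \<open>u\<close>.\<close>
  have "q ^ ?d / of_nat (fact ?d) = q ^ (s + (?d - v - s) + v) / (q ^ v * of_nat m)"
    using sv unfolding m(3) by (simp add: q_def)
  also have "\<dots> = q ^ s * (q ^ (?d - v - s) * to_fract u)"
    using q m0 mu by (simp add: field_simps power_add)
  also have "\<dots> = q ^ s * to_fract (of_nat (CARD('p) ^ (?d - v - s)) * u)"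
    by (simp only: q_def to_fract_mult of_nat_fract[symmetric]) (simp only: of_nat_power)
  finally show ?thesis unfolding q_def by blast
qed

section \<open>Polynomials in t and \<lambda> with coefficients in R\<close>

lemma subring_pred_zring:
  "subring_pred (\<lambda>f :: 'p::prime_card zpoly. to_fract f \<in> zring g)"
proof -
  have c: "to_fract (zconst (to_fract c)) \<in> zring g" for c :: "'p padic_int"
    by (rule zring.const)
  have minus: "zconst (to_fract (-1 :: 'p padic_int)) = - (1 :: 'p zpoly)"
    by (simp add: zconst_def single_uminus)
  have "to_fract (- f) \<in> zring g" if "to_fract f \<in> zring g" for f :: "'p zpoly"
    using zring.mult[OF c[of "-1"] that] unfolding minus by simp
  thus ?thesis
    using c[of 0] c[of 1] by (auto simp: subring_pred_def zconst_def intro: zring.add zring.mult)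
qed

text \<open>Coefficients in \<open>zring g\<close> are what the remainders in \<open>zcong\<close>
  require, and the rules of \<open>zring\<close> supply the constants and variables
  directly.\<close>

abbreviation integral_poly :: "nat \<Rightarrow> 'p::prime_card zpoly poly poly \<Rightarrow> bool"
  where "integral_poly g \<equiv> poly_all (poly_all (\<lambda>f. to_fract f \<in> zring g))"

lemma subring_pred_integral_poly: "subring_pred (integral_poly g :: 'p::prime_card zpoly poly poly \<Rightarrow> bool)"
  by (intro subring_pred_poly_all subring_pred_zring)

lemma integral_poly_mult: "integral_poly g F \<Longrightarrow> integral_poly g H \<Longrightarrow> integral_poly g (F * H)"
  and integral_poly_diff: "integral_poly g F \<Longrightarrow> integral_poly g H \<Longrightarrow> integral_poly g (F - H)"
  for F H :: "'p::prime_card zpoly poly poly"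
  using subring_pred_integral_poly[of g] unfolding subring_pred_def
  by (blast, metis diff_conv_add_uminus)

lemma integral_poly_of_nat: "integral_poly g (of_nat n :: 'p::prime_card zpoly poly poly)"
  using subring_pred_integral_poly[of g, where 'p='p]
  by (induction n) (auto simp: subring_pred_def)

lemma zring_0_1: "to_fract (0 :: 'p::prime_card zpoly) \<in> zring g" "to_fract (1 :: 'p zpoly) \<in> zring g"
  using subring_pred_zring[of g] unfolding subring_pred_def by blast+

lemma integral_poly_const: "to_fract c \<in> zring g \<Longrightarrow> integral_poly g [:[:c:]:]"
  and integral_poly_lam: "integral_poly g (var_lam :: 'p zpoly poly poly)"
  and integral_poly_t: "integral_poly g (var_t :: 'p zpoly poly poly)"
  for c :: "'p::prime_card zpoly"
  using zring_0_1[of g, where 'p='p]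
  by (auto simp: poly_all_def Polynomial.coeff_pCons split: nat.split)

lemma integral_poly_trunc_exp_plt: "integral_poly g (trunc_exp_plt s :: 'p::prime_card zpoly poly poly)"
  unfolding trunc_exp_plt_eq
proof (intro subring_pred_sum[OF subring_pred_integral_poly] integral_poly_mult
    subring_pred_power[OF subring_pred_integral_poly] integral_poly_lam integral_poly_t
    integral_poly_const)
  show "to_fract (zconst (of_nat CARD('p) ^ k / of_nat (fact k) :: 'p padic)) \<in> zring g" for k
    using power_over_fact_integral[where 'p = 'p and k = k] by (auto intro: zring.const)
qed

text \<open>Differentiation lowers the truncation by one, so p \<lambda> E exceeds the derivative by
  p \<lambda> times the top term of E, whose coefficient p^d / d! is divisible by p^s.\<close>

lemma pderiv_trunc_exp_plt:
  assumes "odd CARD('p::prime_card)"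
  obtains R where "integral_poly g R"
    "pderiv (trunc_exp_plt s :: 'p zpoly poly poly) =
       of_nat CARD('p) * var_lam * trunc_exp_plt s - of_nat CARD('p) ^ s * R"
proof -
  let ?E = "trunc_exp_plt s :: 'p zpoly poly poly"
  define x :: "'p zpoly poly poly" where "x = var_lam * var_t"
  define c :: "nat \<Rightarrow> 'p zpoly poly poly" where "c k = cst3 (of_nat CARD('p) ^ k / of_nat (fact k))" for k
  define n where "n = s * (CARD('p) - 1) div (CARD('p) - 2)"
  have d: "trunc_deg CARD('p) s = Suc n" by (simp add: trunc_deg_def n_def)
  have E: "?E = (\<Sum>k=0..Suc n. c k * x ^ k)"
    by (simp only: trunc_exp_plt_eq d x_def c_def)
  have x: "pderiv x = var_lam"
    by (simp add: x_def pderiv_pCons)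
  have dterm: "pderiv (c k * x ^ k) = of_nat k * c k * x ^ (k - 1) * var_lam" for k
    by (simp add: derivation_mult[OF derivation_pderiv] derivation_power[OF derivation_pderiv] x)
      (simp add: c_def pderiv_pCons)
  \<comment> \<open>This recursion for p^k / k! turns the shifted sum of derivatives back into p
    \<lambda> times a partial sum of E.\<close>
  have c: "of_nat (Suc k) * c (Suc k) = of_nat CARD('p) * c k" for k
  proof -
    have "of_nat (Suc k) * (of_nat CARD('p) ^ Suc k / of_nat (fact (Suc k)) :: 'p padic) =
        of_nat CARD('p) * (of_nat CARD('p) ^ k / of_nat (fact k))"
    proof -
      have "of_nat (fact (Suc k)) = (of_nat (Suc k) * of_nat (fact k) :: 'p padic)"
        by (simp only: fact_Suc of_nat_mult of_nat_id)
      moreover have "of_nat (Suc k) \<noteq> (0 :: 'p padic)"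
        unfolding of_nat_fract by (simp del: of_nat_Suc)
      ultimately show ?thesis by (simp del: of_nat_Suc fact_Suc)
    qed
    thus ?thesis
      unfolding c_def cst3_of_nat[symmetric] cst3_mult[symmetric] by (simp only:)
  qed
  obtain u where u: "(of_nat CARD('p) ^ Suc n / of_nat (fact (Suc n)) :: 'p padic)
      = of_nat CARD('p) ^ s * to_fract u"
    using power_trunc_deg_over_fact[OF assms, of s] unfolding d by blast
  have cd: "c (Suc n) = of_nat CARD('p) ^ s * cst3 (to_fract u)"
    unfolding c_def u cst3_mult by (simp only: cst3_of_nat flip: of_nat_power)
  define R where "R = of_nat CARD('p) * var_lam * (cst3 (to_fract u) * x ^ Suc n)"
  have "pderiv ?E = (\<Sum>k=0..n. of_nat (Suc k) * c (Suc k) * x ^ k * var_lam)"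
    unfolding E derivation_sum[OF derivation_pderiv] dterm
    by (subst sum.atLeast0_atMost_Suc_shift) simp
  also have "\<dots> = of_nat CARD('p) * var_lam * (\<Sum>k=0..n. c k * x ^ k)"
    by (simp only: c sum_distrib_left mult_ac)
  also have "(\<Sum>k=0..n. c k * x ^ k) = ?E - c (Suc n) * x ^ Suc n"
    unfolding E by simp
  finally have "pderiv ?E = of_nat CARD('p) * var_lam * ?E - of_nat CARD('p) ^ s * R"
    unfolding cd R_def by (simp only: right_diff_distrib mult_ac)
  moreover have "integral_poly g R"
    unfolding R_def x_def cst3_of_nat[symmetric] of_nat_fract
    by (intro integral_poly_mult integral_poly_const zring.const integral_poly_lam integral_poly_t
        subring_pred_power[OF subring_pred_integral_poly])
  ultimately show thesis using that by blast
qed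

text \<open>E depends on \<lambda> and t only through their product, and the Euler operators of both
  variables agree on powers of that product.\<close>

lemma lam_derivative_trunc_exp_plt:
  "var_lam * map_poly pderiv (trunc_exp_plt s) = var_t * pderiv (trunc_exp_plt s :: 'p::prime_card zpoly poly poly)"
proof -
  let ?Dl = "map_poly pderiv :: 'p zpoly poly poly \<Rightarrow> _"
  let ?x = "var_lam * var_t :: 'p zpoly poly poly"
  have Dl: "derivation ?Dl" by (intro derivation_map_poly derivation_pderiv)
  note Dt = derivation_pderiv[where 'a = "'p zpoly poly"]
  have xt: "pderiv ?x = var_lam" by (simp add: pderiv_pCons)
  have "?Dl ?x = ?Dl var_lam * var_t + var_lam * ?Dl var_t"
    by (rule derivation_mult[OF Dl])
  hence xl: "?Dl ?x = var_t"
    unfolding map_poly_derivation_X[OF derivation_pderiv]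
      map_poly_derivation_const[OF derivation_pderiv] by (simp add: pderiv_pCons)
  have "var_lam * ?Dl (cst3 a * ?x ^ k) = var_t * pderiv (cst3 a * ?x ^ k)" for a k
    unfolding derivation_mult[OF Dl, of "cst3 a"] derivation_mult[OF Dt, of "cst3 a"]
      derivation_power[OF Dl] derivation_power[OF Dt] xt xl
      map_poly_derivation_const[OF derivation_pderiv]
    by (simp only: pderiv_pCons pderiv_0 mult_zero_left pCons_0_0 add_0_left mult_ac)
  thus ?thesis
    by (simp only: trunc_exp_plt_eq derivation_sum[OF Dl] derivation_sum[OF Dt] sum_distrib_left)
qed


section \<open>The equations modulo \<open>p\<^sup>s\<close>\<close>

text \<open>Extracting a coefficient in t and then substituting \<lambda> is linear over polynomials
  in z and \<lambda>, so identities between polynomials pass to the field where \<open>zcong\<close>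
  lives.\<close>

definition coeff_at :: "nat \<Rightarrow> 'p::prime_card padic_int \<Rightarrow> 'p zpoly poly poly \<Rightarrow> 'p zrat"
  where "coeff_at N lam F = at_lam lam (Polynomial.coeff F N)"

lemma coeff_at_add: "coeff_at N lam (F + H) = coeff_at N lam F + coeff_at N lam H"
  and coeff_at_diff: "coeff_at N lam (F - H) = coeff_at N lam F - coeff_at N lam H"
  and coeff_at_uminus: "coeff_at N lam (- F) = - coeff_at N lam F"
  and coeff_at_const: "coeff_at N lam ([:[:c:]:] * F) = to_fract c * coeff_at N lam F"
  and coeff_at_lam: "coeff_at N lam (var_lam * F) = lamval lam * coeff_at N lam F"
  by (simp_all add: coeff_at_def at_lam_def lamval_def)

lemma coeff_at_sum: "coeff_at N lam (sum f A) = (\<Sum>x\<in>A. coeff_at N lam (f x))"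
  by (induction A rule: infinite_finite_induct)
    (simp_all add: coeff_at_add, simp_all add: coeff_at_def at_lam_def)

lemma coeff_at_of_nat: "coeff_at N lam (of_nat n * F) = of_nat n * coeff_at N lam F"
  by (induction n) (simp_all add: coeff_at_add algebra_simps, simp add: coeff_at_def at_lam_def)

lemma coeff_at_of_nat_power: "coeff_at N lam (of_nat n ^ k * F) = of_nat n ^ k * coeff_at N lam F"
  using coeff_at_of_nat[of N lam "n ^ k"] by simp

lemma zring_subring: "subring_pred (\<lambda>x. x \<in> zring g)"
proof -
  have "to_fract (zconst (to_fract (-1 :: 'a padic_int))) = (- 1 :: 'a zrat)"
    by (simp add: zconst_def single_uminus)
  hence "- x \<in> zring g" if "x \<in> zring g" for x :: "'a zrat"
    using zring.mult[OF zring.const[of "-1"] that] by simp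
  thus ?thesis
    using zring_0_1[of g, where 'p='a] by (auto simp: subring_pred_def intro: zring.add zring.mult)
qed

lemma coeff_at_in_zring:
  assumes "integral_poly g F"
  shows "coeff_at N lam F \<in> zring g"
proof -
  have "to_fract (zconst (to_fract lam)) \<in> zring g" by (rule zring.const)
  moreover have "to_fract (Polynomial.coeff (Polynomial.coeff F N) k) \<in> zring g" for k
    using assms by (simp add: poly_all_def)
  ultimately show ?thesis
    unfolding coeff_at_def at_lam_def poly_altdef
    by (intro subring_pred_sum[OF subring_pred_zring])
      (metis subring_pred_power[OF subring_pred_zring] to_fract_mult zring.mult)
qed

text \<open>Differentiation multiplies the coefficient of t^n by n. With n = l p^s this lands at
  t^(n - 1), the exponent defining I, and brings out p^s; \<open>l > 0\<close> makes the truncated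
  \<open>n - 1\<close> a true predecessor.\<close>

lemma coeff_at_pderiv:
  assumes "l > 0" "integral_poly g F"
  obtains r where "r \<in> zring g"
    "coeff_at (l * CARD('p) ^ s - 1) lam (pderiv F) = of_nat CARD('p::prime_card) ^ s * r"
proof -
  let ?n = "l * CARD('p) ^ s"
  have n: "Suc (?n - 1) = ?n"
    using assms(1) by simp
  have "coeff_at (?n - 1) lam (pderiv F) = coeff_at ?n lam (of_nat ?n * F)"
    unfolding coeff_at_def coeff_pderiv n of_nat_poly by simp
  also have "\<dots> = of_nat CARD('p) ^ s * (of_nat l * coeff_at ?n lam F)"
    by (simp add: coeff_at_of_nat del: of_nat_mult) (simp add: mult_ac)
  also have "of_nat l * coeff_at ?n lam F = coeff_at ?n lam (of_nat l * F)"
    by (simp add: coeff_at_of_nat)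
  finally have "coeff_at (?n - 1) lam (pderiv F) =
      of_nat CARD('p) ^ s * coeff_at ?n lam (of_nat l * F)" .
  moreover have "coeff_at ?n lam (of_nat l * F) \<in> zring g"
    by (intro coeff_at_in_zring integral_poly_mult integral_poly_of_nat assms)
  ultimately show thesis using that by blast
qed

locale kz_setting =
  fixes g s l N M :: nat and lam :: "'p::prime_card padic_int"
  assumes p: "odd CARD('p)" and s: "s > 0" and l: "l > 0"
    and N: "N = l * CARD('p) ^ s - 1" and M: "M = (CARD('p) ^ s - 1) div 2"
begin

abbreviation (input) E where "E \<equiv> trunc_exp_plt s :: 'p zpoly poly poly"
abbreviation (input) A where "A \<equiv> {1..2*g+1}"
abbreviation (input) d where "d k \<equiv> var_t - var_z k :: 'p zpoly poly poly"
abbreviation (input) W where "W \<equiv> reduced_prod A d M"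
abbreviation (input) Dz where "Dz i \<equiv> map_poly (map_poly (zderiv i)) :: 'p zpoly poly poly \<Rightarrow> _"
abbreviation (input) Dl where "Dl \<equiv> map_poly pderiv :: 'p zpoly poly poly \<Rightarrow> _"
abbreviation (input) z where "z k \<equiv> to_fract (zvar k) :: 'p zrat"
abbreviation (input) q where "q \<equiv> of_nat CARD('p) :: 'p zrat"

section \<open>The derivations on E and on the factors t - z_k\<close>

lemma derivation_Dz: "derivation (Dz i)" and derivation_Dl: "derivation Dl"
  by (intro derivation_map_poly derivation_zderiv derivation_pderiv)+

lemma master_eq: "master g s j = E * W {j}"
  by (simp only: master_def reduced_prod_def M singleton_iff)

lemma M_pos: "M > 0"
proof -
  have "CARD('p) ^ 1 \<le> CARD('p) ^ s"
    using s odd_prime_card_ge_3[OF p] by (intro power_increasing) auto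
  thus ?thesis using odd_prime_card_ge_3[OF p] by (simp add: M)
qed

lemma d_nonzero: "d k \<noteq> 0"
  by simp

lemma Dz_const: "Dz i [:[:c:]:] = [:[:zderiv i c:]:]"
  by (simp only: map_poly_derivation_const derivation_map_poly derivation_zderiv)

lemma Dz_t: "Dz i var_t = 0"
  by (simp only: map_poly_derivation_X derivation_map_poly derivation_zderiv)

lemma Dz_lam: "Dz i var_lam = 0"
  by (simp only: map_poly_derivation_const map_poly_derivation_X derivation_map_poly derivation_zderiv pCons_0_0)

lemma Dz_d: "Dz i (d k) = (if i = k then - 1 else 0)"
  unfolding derivation_diff[OF derivation_Dz] Dz_t Dz_const zderiv_zvar
  by (simp add: one_pCons)

lemma Dz_E: "Dz i E = 0"
  unfolding trunc_exp_plt_eq derivation_sum[OF derivation_Dz] derivation_mult[OF derivation_Dz]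
    derivation_power[OF derivation_Dz] Dz_const Dz_t Dz_lam zderiv_zconst
  by simp

lemma Dl_d: "Dl (d k) = 0"
  unfolding derivation_diff[OF derivation_Dl] map_poly_derivation_X[OF derivation_pderiv]
    map_poly_derivation_const[OF derivation_pderiv] by (simp add: pderiv_pCons)

lemma Dt_d: "pderiv (d k) = 1"
  by (simp add: pderiv_pCons pderiv_diff one_pCons)

text \<open>The derivative along z_i kills \<open>E\<close> and every factor except
  \<open>d i\<close>, which it sends to -1, so one term of the general identity survives.\<close>

lemma Dz_master:
  assumes "i \<in> A" "j \<in> A" "i \<noteq> j"
  shows "Dz i (E * W {j}) = - (of_nat M * (E * W {i, j}))"
proof -
  have "Dz i (E * W {j}) = Dz i E * W {j} +
      of_nat M * (\<Sum>k\<in>A - {j}. Dz i (d k) * (E * W {k, j}))"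
    by (rule derivation_times_reduced_prod)
      (use assms M_pos in \<open>simp_all only: derivation_Dz d_nonzero Dz_d finite_atLeastAtMost if_False
         not_False_eq_True\<close>)
  also have "(\<Sum>k\<in>A - {j}. Dz i (d k) * (E * W {k, j})) =
      (\<Sum>k\<in>A - {j}. if k = i then - (E * W {k, j}) else 0)"
    unfolding Dz_d by (intro sum.cong) auto
  also have "\<dots> = - (E * W {i, j})"
    using assms by (subst sum.delta) auto
  finally show ?thesis by (simp add: Dz_E)
qed

text \<open>The sum of the derivatives along z_i and t kills \<open>d i\<close> and sends every
  other \<open>d k\<close> to 1, as the general identity requires.\<close>

lemma Dz_plus_Dt_master:
  assumes "i \<in> A"
  shows "Dz i (E * W {i}) + pderiv (E * W {i}) =
    pderiv E * W {i} + of_nat M * (\<Sum>k\<in>A - {i}. E * W {k, i})"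
proof -
  have "Dz i (E * W {i}) + pderiv (E * W {i}) = (Dz i E + pderiv E) * W {i} +
      of_nat M * (\<Sum>k\<in>A - {i}. (Dz i (d k) + pderiv (d k)) * (E * W {k, i}))"
    by (rule derivation_times_reduced_prod[of "\<lambda>x. Dz i x + pderiv x"])
      (use assms M_pos in \<open>simp_all only: derivation_plus derivation_Dz derivation_pderiv d_nonzero
         Dz_d Dt_d finite_atLeastAtMost if_True refl not_False_eq_True add.left_inverse\<close>)
  also have "(\<Sum>k\<in>A - {i}. (Dz i (d k) + pderiv (d k)) * (E * W {k, i})) =
      (\<Sum>k\<in>A - {i}. E * W {k, i})"
    unfolding Dz_d Dt_d by (intro sum.cong) auto
  finally show ?thesis by (simp add: Dz_E)
qed

text \<open>Only \<open>E\<close> involves \<lambda>, and its \<lambda>-derivative trades for a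
  t-derivative with a factor t = (t - z_i) + z_i. The part t - z_i completes \<open>W {i}\<close> to
  \<open>W {}\<close>, where the product rule applies.\<close>

lemma lam_Dl_master:
  assumes "i \<in> A"
  shows "var_lam * Dl (E * W {i}) =
    pderiv (E * W {}) - of_nat M * (\<Sum>k\<in>A. E * W {k}) + var_z i * (pderiv E * W {i})"
proof -
  have "Dl (E * W {i}) = Dl E * W {i} +
      of_nat M * (\<Sum>k\<in>A - {i}. Dl (d k) * (E * W {k, i}))"
    by (rule derivation_times_reduced_prod)
      (use assms M_pos in \<open>simp_all only: derivation_Dl d_nonzero Dl_d finite_atLeastAtMost
         not_False_eq_True\<close>)
  hence 1: "Dl (E * W {i}) = Dl E * W {i}"
    unfolding Dl_d by simp
  have 2: "W {i} * d i = W {}"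
    using assms M_pos by (intro reduced_prod_insert) auto
  have "pderiv (E * W {}) = pderiv E * W {} + E * (of_nat M * (\<Sum>k\<in>A. pderiv (d k) * W {k}))"
    by (simp only: derivation_mult[OF derivation_pderiv]
        derivation_reduced_prod_empty[OF derivation_pderiv finite_atLeastAtMost])
  hence 3: "pderiv (E * W {}) = pderiv E * W {} + of_nat M * (\<Sum>k\<in>A. E * W {k})"
    by (simp only: Dt_d mult_1_left sum_distrib_left mult_ac)
  have "var_lam * Dl (E * W {i}) = var_t * pderiv E * W {i}"
    unfolding 1 lam_derivative_trunc_exp_plt[symmetric] by (simp only: mult_ac)
  also have "\<dots> = (pderiv E * (W {i} * d i) + of_nat M * (\<Sum>k\<in>A. E * W {k}))
      - of_nat M * (\<Sum>k\<in>A. E * W {k}) + var_z i * (pderiv E * W {i})"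
    by (simp only: right_diff_distrib left_diff_distrib add_diff_cancel_right' diff_add_cancel mult_ac)
  finally show ?thesis unfolding 2 3 .
qed

text \<open>Partial fractions for 1 / (t - z_i) - 1 / (t - z_j): this makes the quotients in the KZ
  equations coefficients of polynomials.\<close>

lemma master_diff:
  assumes "i \<in> A" "j \<in> A" "i \<noteq> j"
  shows "E * W {i} - E * W {j} = [:[:zvar i - zvar j:]:] * (E * W {i, j})"
proof -
  have "W (insert j {i}) * d j = W {i}" "W (insert i {j}) * d i = W {j}"
    using assms M_pos by (intro reduced_prod_insert; auto)+
  hence "E * W {i} - E * W {j} = (d j - d i) * (E * W {i, j})"
    by (simp only: insert_commute[of j i] left_diff_distrib right_diff_distrib mult_ac)
  thus ?thesis by simp
qed

section \<open>Integrality of the products, and I as their coefficient\<close>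

lemma integral_W: "integral_poly g (W B)"
  unfolding reduced_prod_def
  by (intro subring_pred_prod[OF subring_pred_integral_poly] integral_poly_t integral_poly_diff
      subring_pred_power[OF subring_pred_integral_poly] integral_poly_const zring.var)

lemma integral_E_W: "integral_poly g (E * W B)"
  by (intro integral_poly_mult integral_W integral_poly_trunc_exp_plt)

lemma at_lam_Isol: "at_lam lam (Isol g s l j) = coeff_at N lam (E * W {j})"
  by (simp only: Isol_def master_eq coeff_at_def N)

lemma at_lam_zderiv_Isol:
  "at_lam lam (map_poly (zderiv i) (Isol g s l j)) = coeff_at N lam (Dz i (E * W {j}))"
  using derivation_0[OF derivation_map_poly[OF derivation_zderiv, of i]]
  by (simp add: Isol_def master_eq coeff_at_def coeff_map_poly N)

lemma at_lam_pderiv_Isol: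
  "at_lam lam (pderiv (Isol g s l j)) = coeff_at N lam (Dl (E * W {j}))"
  by (simp add: Isol_def master_eq coeff_at_def coeff_map_poly N)

lemma lamval_1: "lamval (1 :: 'p padic_int) = 1"
  by (simp add: lamval_def zconst_def)

lemma lamval_add: "lamval (a + b :: 'p padic_int) = lamval a + lamval b"
  by (simp add: lamval_def zconst_def single_add)

lemma lamval_mult: "lamval (a * b :: 'p padic_int) = lamval a * lamval b"
  by (simp only: lamval_def zconst_def to_fract_mult[symmetric] mult_single add_0)

lemma lamval_in_zring: "lamval (a :: 'p padic_int) \<in> zring g"
  unfolding lamval_def by (rule zring.const)

text \<open>For odd \<open>p\<close> the number 2 is a unit of the p-adic integers, so 1/2 lies in
  R.\<close>

lemma half:
  obtains h where "h \<in> zring g" "2 * h = (1 :: 'p zrat)"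
proof -
  have "(of_nat 2 :: 'p padic_int) dvd 1"
    using p by (intro is_unit_of_nat_padic_int) (simp add: prime_imp_coprime)
  then obtain h :: "'p padic_int" where "1 = (1 + 1) * h" by (auto elim: dvdE)
  hence "2 * lamval h = 1"
    by (metis lamval_1 lamval_add lamval_mult one_add_one)
  thus thesis using that lamval_in_zring by blast
qed

text \<open>The exact form of M \<equiv> -1/2 modulo p^s, from 2 M + 1 = p^s; the halving is exact
  because p^s is odd.\<close>

lemma of_nat_M:
  assumes "2 * h = (1 :: 'p zrat)"
  shows "of_nat M = h * q ^ s - h"
proof -
  have "2 * M + 1 = CARD('p) ^ s"
    using p by (simp add: M odd_pos)
  hence "2 * of_nat M + 1 = q ^ s"
    by (metis of_nat_Suc of_nat_mult of_nat_numeral of_nat_power Suc_eq_plus1 add.commute)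
  hence "h * q ^ s - h = (2 * h) * of_nat M"
    by (simp add: algebra_simps flip: \<open>_ = q ^ s\<close>)
  thus ?thesis using assms by simp
qed

lemma zring_times: "x \<in> zring g \<Longrightarrow> y \<in> zring g \<Longrightarrow> x * y \<in> zring g"
  and zring_plus: "x \<in> zring g \<Longrightarrow> y \<in> zring g \<Longrightarrow> x + y \<in> zring g"
  and zring_minus: "x \<in> zring g \<Longrightarrow> - x \<in> zring g" for x y :: "'p zrat"
  using zring_subring[of g, where 'a='p] by (auto simp: subring_pred_def)

section \<open>The three congruences\<close>

lemma diff_quotient:
  assumes "i \<in> A" "j \<in> A" "i \<noteq> j"
  shows "(coeff_at N lam (E * W {i}) - coeff_at N lam (E * W {j})) / (z i - z j) =
    coeff_at N lam (E * W {i, j})"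
proof -
  \<comment> \<open>The derivative along z_i separates the two variables: it is 1 on one and 0 on
    the other.\<close>
  have "zvar i \<noteq> (zvar j :: 'p zpoly)"
    using assms(3) zderiv_zvar[of i i, where 'a="'p padic"] zderiv_zvar[of i j, where 'a="'p padic"]
    by auto
  hence "z i - z j \<noteq> 0" by simp
  thus ?thesis
    unfolding coeff_at_diff[symmetric] master_diff[OF assms] coeff_at_const by simp
qed

lemma KZ_off_diagonal:
  assumes "i \<in> A" "j \<in> A" "i \<noteq> j"
  shows "zcong g s (coeff_at N lam (Dz i (E * W {j})))
    (1 / 2 * ((coeff_at N lam (E * W {i}) - coeff_at N lam (E * W {j})) / (z i - z j)))"
proof -
  obtain h where h: "h \<in> zring g" "2 * h = (1 :: 'p zrat)" by (rule half)
  hence h2: "1 / 2 = h" by (metis nonzero_mult_div_cancel_left mult_zero_left zero_neq_one)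
  let ?c = "coeff_at N lam (E * W {i, j})"
  \<comment> \<open>The remainder comes from -M - h = -h p^s, with h = 1/2.\<close>
  have "coeff_at N lam (Dz i (E * W {j})) - h * ?c = q ^ s * - (h * ?c)"
    unfolding Dz_master[OF assms] coeff_at_uminus coeff_at_of_nat of_nat_M[OF h(2)]
    by (simp add: algebra_simps)
  thus ?thesis
    unfolding zcong_def diff_quotient[OF assms] h2
    using zring_minus[OF zring_times[OF h(1) coeff_at_in_zring[OF integral_E_W]]] by blast
qed

text \<open>Adding the t-derivative gives a derivation that kills t - z_i; subtracting it again
  costs only a multiple of p^s.\<close>

lemma KZ_diagonal:
  assumes "i \<in> A"
  shows "zcong g s (coeff_at N lam (Dz i (E * W {i})))
    (q * lamval lam * coeff_at N lam (E * W {i}) - 1 / 2 * (\<Sum>j\<in>A - {i}.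
       (coeff_at N lam (E * W {i}) - coeff_at N lam (E * W {j})) / (z i - z j)))"
proof -
  obtain h where h: "h \<in> zring g" "2 * h = (1 :: 'p zrat)" by (rule half)
  hence h2: "1 / 2 = h" by (metis nonzero_mult_div_cancel_left mult_zero_left zero_neq_one)
  obtain R where R: "integral_poly g R"
      "pderiv E = of_nat CARD('p) * var_lam * E - of_nat CARD('p) ^ s * R"
    by (rule pderiv_trunc_exp_plt[OF p])
  obtain r where r: "r \<in> zring g" "coeff_at N lam (pderiv (E * W {i})) = q ^ s * r"
    unfolding N by (rule coeff_at_pderiv[OF l integral_E_W])
  let ?S = "\<Sum>k\<in>A - {i}. E * W {k, i}"
  let ?c = "coeff_at N lam"
  have quot: "(\<Sum>j\<in>A - {i}. (?c (E * W {i}) - ?c (E * W {j})) / (z i - z j)) = ?c ?S"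
    unfolding coeff_at_sum
  proof (rule sum.cong[OF refl])
    fix j assume "j \<in> A - {i}"
    thus "(?c (E * W {i}) - ?c (E * W {j})) / (z i - z j) = ?c (E * W {j, i})"
      using diff_quotient[OF assms, of j] by (simp add: insert_commute)
  qed
  have "Dz i (E * W {i}) = of_nat CARD('p) * (var_lam * (E * W {i})) -
      of_nat (CARD('p) ^ s) * (R * W {i}) + of_nat M * ?S - pderiv (E * W {i})"
    using Dz_plus_Dt_master[OF assms]
    unfolding R(2) of_nat_power by (simp only: eq_diff_eq left_diff_distrib mult.assoc)
  hence "?c (Dz i (E * W {i})) = q * (lamval lam * ?c (E * W {i})) -
      q ^ s * ?c (R * W {i}) + (h * q ^ s - h) * ?c ?S - q ^ s * r"
    by (simp only: coeff_at_add coeff_at_diff coeff_at_of_nat coeff_at_lam r(2) of_nat_M[OF h(2)]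
        of_nat_power coeff_at_of_nat_power)
  \<comment> \<open>The three error terms come from truncating E, from replacing M by -1/2, and from
    the t-derivative.\<close>
  hence "?c (Dz i (E * W {i})) - (q * lamval lam * ?c (E * W {i}) - h * ?c ?S) =
      q ^ s * (- ?c (R * W {i}) + h * ?c ?S + - r)"
    by (simp add: algebra_simps)
  moreover have "- ?c (R * W {i}) + h * ?c ?S + - r \<in> zring g"
    by (intro zring_plus zring_minus zring_times r(1) h(1) coeff_at_in_zring integral_poly_mult R(1)
        integral_W subring_pred_sum[OF subring_pred_integral_poly] integral_poly_trunc_exp_plt)
  ultimately show ?thesis
    unfolding zcong_def quot h2 by blast
qed

text \<open>In \<open>lam_Dl_master\<close>, the sum weighted by -M gives the term with 1/2, and z_i
  times the derivative of E gives p \<lambda> z_i I_i. Dividing by \<lambda> stays within R because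
  \<lambda> is a unit.\<close>

lemma dynamical:
  assumes "i \<in> A" "lam dvd 1"
  shows "zcong g s (coeff_at N lam (Dl (E * W {i})))
    (q * z i * coeff_at N lam (E * W {i}) +
      1 / (2 * lamval lam) * (\<Sum>j\<in>A. coeff_at N lam (E * W {j})))"
proof -
  obtain h where h: "h \<in> zring g" "2 * h = (1 :: 'p zrat)" by (rule half)
  obtain mu where "1 = lam * mu" using assms(2) by (rule dvdE)
  hence mu: "lamval lam * lamval mu = 1" by (metis lamval_1 lamval_mult)
  have "(2 * lamval lam) * (h * lamval mu) = (2 * h) * (lamval lam * lamval mu)"
    by (simp only: mult_ac)
  hence "(2 * lamval lam) * (h * lamval mu) = 1" using h mu by simp
  hence hmu: "1 / (2 * lamval lam) = h * lamval mu"
    by (metis nonzero_mult_div_cancel_left mult_zero_left zero_neq_one)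
  obtain R where R: "integral_poly g R"
      "pderiv E = of_nat CARD('p) * var_lam * E - of_nat CARD('p) ^ s * R"
    by (rule pderiv_trunc_exp_plt[OF p])
  obtain r where r: "r \<in> zring g" "coeff_at N lam (pderiv (E * W {})) = q ^ s * r"
    unfolding N by (rule coeff_at_pderiv[OF l integral_E_W])
  let ?S = "\<Sum>k\<in>A. E * W {k}"
  let ?c = "coeff_at N lam"
  have "var_lam * Dl (E * W {i}) = pderiv (E * W {}) - of_nat M * ?S +
      var_z i * (of_nat CARD('p) * (var_lam * (E * W {i})) - of_nat (CARD('p) ^ s) * (R * W {i}))"
    unfolding lam_Dl_master[OF assms(1)] R(2) of_nat_power
    by (simp only: left_diff_distrib mult.assoc)
  hence "?c (var_lam * Dl (E * W {i})) = ?c \<dots>" by (rule arg_cong)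
  hence "lamval lam * ?c (Dl (E * W {i})) = q ^ s * r - (h * q ^ s - h) * ?c ?S +
      z i * (q * (lamval lam * ?c (E * W {i})) - q ^ s * ?c (R * W {i}))"
    by (simp only: coeff_at_add coeff_at_diff coeff_at_of_nat coeff_at_lam coeff_at_const r(2)
        of_nat_M[OF h(2)] of_nat_power coeff_at_of_nat_power)
  hence "lamval mu * (lamval lam * ?c (Dl (E * W {i}))) = lamval mu * \<dots>" by (rule arg_cong)
  also have "lamval mu * (lamval lam * ?c (Dl (E * W {i}))) =
      (lamval lam * lamval mu) * ?c (Dl (E * W {i}))" by (simp only: mult_ac)
  \<comment> \<open>Keeping \<open>lamval lam * lamval mu\<close> as a factor makes this regrouping
    a pure ring identity; it becomes 1 in the next step.\<close>
  also have "lamval mu * (q ^ s * r - (h * q ^ s - h) * ?c ?S +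
      z i * (q * (lamval lam * ?c (E * W {i})) - q ^ s * ?c (R * W {i}))) =
      (lamval lam * lamval mu) * (q * z i * ?c (E * W {i})) + h * lamval mu * ?c ?S +
      q ^ s * (lamval mu * (r + - (h * ?c ?S) + - (z i * ?c (R * W {i}))))"
    by (simp add: algebra_simps)
  finally have "?c (Dl (E * W {i})) - (q * z i * ?c (E * W {i}) + h * lamval mu * ?c ?S) =
      q ^ s * (lamval mu * (r + - (h * ?c ?S) + - (z i * ?c (R * W {i}))))"
    unfolding mu by (simp add: algebra_simps)
  moreover have "lamval mu * (r + - (h * ?c ?S) + - (z i * ?c (R * W {i}))) \<in> zring g"
    by (intro zring_plus zring_minus zring_times r(1) h(1) coeff_at_in_zring integral_poly_mult R(1)
        integral_W subring_pred_sum[OF subring_pred_integral_poly] integral_poly_trunc_exp_plt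
        lamval_in_zring zring.var assms(1))
  ultimately show ?thesis
    unfolding zcong_def hmu coeff_at_sum[symmetric] by blast
qed

lemma KZ_solution_mod_Isol: "KZ_solution_mod g s lam (Isol g s l)"
  unfolding KZ_solution_mod_def at_lam_zderiv_Isol at_lam_Isol
  using KZ_off_diagonal KZ_diagonal by blast

lemma dynamical_solution_mod_Isol: "lam dvd 1 \<Longrightarrow> dynamical_solution_mod g s lam (Isol g s l)"
  unfolding dynamical_solution_mod_def at_lam_pderiv_Isol at_lam_Isol
  using dynamical by blast

end

theorem theorem1p5:
  fixes g s l :: nat
  assumes "odd CARD('p::prime_card)" and "g > 0" and "s > 0" and "l > 0"
  shows "(\<forall>lam :: 'p padic_int. KZ_solution_mod g s lam (Isol g s l)) \<and>
    (\<forall>lam :: 'p padic_int. lam dvd 1 \<longrightarrow> dynamical_solution_mod g s lam (Isol g s l))"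
proof -
  \<comment> \<open>The predicate \<open>kz_setting\<close> takes neither \<open>g\<close> nor
    \<open>lam\<close>, so one instance serves every \<lambda> in both claims.\<close>
  have "kz_setting TYPE('p) s l (l * CARD('p) ^ s - 1) ((CARD('p) ^ s - 1) div 2)"
    using assms by unfold_locales auto
  thus ?thesis
    using kz_setting.KZ_solution_mod_Isol kz_setting.dynamical_solution_mod_Isol by blast
qed

end
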